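(* For every $E(X,(x_n))\in\mathcal{A}_U$ we have $E(X,(x_n))\leq_B E(U_1,(u_n))$, and for every $E(X,(x_n))\in\mathcal{A}$ we have $E(X,(x_n))\leq_B E(U_2,(v_n))$.
   Context: $\mathbb{N}=\{0,1,2,\ldots\}$; Banach spaces are over $\mathbb{R}$. For a basic sequence $\{x_n\}$ in a Banach space $X$ (a Schauder basis, indexed by $\mathbb{N}$, of its closed linear span), $\mathrm{coef}(X,(x_n))$ is the set of all $a=(a_n)\in\mathbb{R}^{\mathbb{N}}$ such that $\sum_n a_nx_n$ converges in $X$, and $E(X,(x_n))$ is the (Borel) equivalence relation on $\mathbb{R}^{\mathbb{N}}$ given by $(x,y)\in E(X,(x_n)) \iff x-y\in \mathrm{coef}(X,(x_n))$. A basic sequence is unconditional if every convergent series $\sum a_nx_n$ converges unconditionally. $\mathcal{A}$ is the class of all equivalence relations of the form $E(X,(x_n))$ with $X$ a Banach space and $\{x_n\}$ a basic sequence in $X$; $\mathcal{A}_U$ is the subclass of those with $\{x_n\}$ unconditional. Basic sequences $\{x_n\}$ in $X$ and $\{y_n\}$ in $Y$ are equivalent if $\mathrm{coef}(X,(x_n))=\mathrm{coef}(Y,(y_n))$. $U_1$ and $U_2$ are the universal separable Banach spaces constructed by Pelczynski: $U_1$ has an unconditional basis $\{u_n\}$ such that every unconditional basic sequence (in an arbitrary separable Banach space) is equivalent to a subsequence of $\{u_n\}$; $U_2$ has a Schauder basis $\{v_n\}$ such that every basic sequence is equivalent to a subsequence of $\{v_n\}$. For equivalence relations $E,F$ on Polish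 spaces $P,Q$, $E\leq_B F$ means that there is a Borel $\theta:P\to Q$ with $xEy\iff\theta(x)F\theta(y)$ for all $x,y\in P$. *)

theory Defs
  imports "HOL-Analysis.Analysis" "HOL-Library.Function_Algebras"
begin

section \<open>Banach spaces as normed linear subspaces\<close>

text \<open>
  The universality of \<open>U\<^sub>1\<close> and \<open>U\<^sub>2\<close> is a statement about all separable Banach spaces, and a
  hypothesis cannot quantify over the types of class \<^class>\<open>banach\<close>. A Banach space is therefore
  given here by a linear subspace \<open>V\<close> of a real vector space together with a norm \<open>N\<close> on \<open>V\<close>; the
  values of \<open>N\<close> outside \<open>V\<close> are irrelevant. A type of class \<^class>\<open>banach\<close> is the case
  \<open>V = UNIV\<close>, \<open>N = norm\<close> (see \<open>banach_space_UNIV\<close> and the lemmas after it).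
\<close>

text \<open>The value outside \<open>V\<close> only serves to meet the global axioms of \<^locale>\<open>Metric_space\<close>.\<close>

definition norm_metric :: "'a::real_vector set \<Rightarrow> ('a \<Rightarrow> real) \<Rightarrow> 'a \<Rightarrow> 'a \<Rightarrow> real"
  where "norm_metric V N x y = (if x \<in> V \<and> y \<in> V then N (x - y) else 0)"

definition norm_topology :: "'a::real_vector set \<Rightarrow> ('a \<Rightarrow> real) \<Rightarrow> 'a topology"
  where "norm_topology V N = Metric_space.mtopology V (norm_metric V N)"

definition banach_space :: "'a::real_vector set \<Rightarrow> ('a \<Rightarrow> real) \<Rightarrow> bool"
  where "banach_space V N \<longleftrightarrow>
    subspace V \<and>
    (\<forall>x\<in>V. 0 \<le> N x) \<and>
    (\<forall>x\<in>V. N x = 0 \<longleftrightarrow> x = 0) \<and>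
    (\<forall>x\<in>V. \<forall>y\<in>V. N (x + y) \<le> N x + N y) \<and>
    (\<forall>x\<in>V. \<forall>c. N (c *\<^sub>R x) = \<bar>c\<bar> * N x) \<and>
    Metric_space.mcomplete V (norm_metric V N)"

definition series_sums :: "'a::real_vector set \<Rightarrow> ('a \<Rightarrow> real) \<Rightarrow> (nat \<Rightarrow> 'a) \<Rightarrow> 'a \<Rightarrow> bool"
  where "series_sums V N f s \<longleftrightarrow> limitin (norm_topology V N) (\<lambda>n. \<Sum>i<n. f i) s sequentially"

definition series_converges :: "'a::real_vector set \<Rightarrow> ('a \<Rightarrow> real) \<Rightarrow> (nat \<Rightarrow> 'a) \<Rightarrow> bool"
  where "series_converges V N f \<longleftrightarrow> (\<exists>s. series_sums V N f s)"


section \<open>Basic sequences\<close>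

definition schauder_basis :: "'a::real_vector set \<Rightarrow> ('a \<Rightarrow> real) \<Rightarrow> (nat \<Rightarrow> 'a) \<Rightarrow> bool"
  where "schauder_basis V N x \<longleftrightarrow>
    range x \<subseteq> V \<and> (\<forall>v\<in>V. \<exists>!a :: nat \<Rightarrow> real. series_sums V N (\<lambda>n. a n *\<^sub>R x n) v)"

definition closed_span :: "'a::real_vector set \<Rightarrow> ('a \<Rightarrow> real) \<Rightarrow> (nat \<Rightarrow> 'a) \<Rightarrow> 'a set"
  where "closed_span V N x = norm_topology V N closure_of span (range x)"

definition basic_sequence :: "'a::real_vector set \<Rightarrow> ('a \<Rightarrow> real) \<Rightarrow> (nat \<Rightarrow> 'a) \<Rightarrow> bool"
  where "basic_sequence V N x \<longleftrightarrow> range x \<subseteq> V \<and> schauder_basis (closed_span V N x) N x"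

definition coef :: "'a::real_vector set \<Rightarrow> ('a \<Rightarrow> real) \<Rightarrow> (nat \<Rightarrow> 'a) \<Rightarrow> (nat \<Rightarrow> real) set"
  where "coef V N x = {a. series_converges V N (\<lambda>n. a n *\<^sub>R x n)}"

text \<open>A series converges unconditionally if all its rearrangements converge.\<close>

definition unconditional :: "'a::real_vector set \<Rightarrow> ('a \<Rightarrow> real) \<Rightarrow> (nat \<Rightarrow> 'a) \<Rightarrow> bool"
  where "unconditional V N x \<longleftrightarrow>
    (\<forall>a\<in>coef V N x. \<forall>\<pi>::nat \<Rightarrow> nat. bij \<pi> \<longrightarrow> series_converges V N (\<lambda>n. a (\<pi> n) *\<^sub>R x (\<pi> n)))"

definition equivalent_sequences ::
    "'a::real_vector set \<Rightarrow> ('a \<Rightarrow> real) \<Rightarrow> (nat \<Rightarrow> 'a) \<Rightarrow>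
     'b::real_vector set \<Rightarrow> ('b \<Rightarrow> real) \<Rightarrow> (nat \<Rightarrow> 'b) \<Rightarrow> bool"
  where "equivalent_sequences V N x W M y \<longleftrightarrow> coef V N x = coef W M y"


section \<open>Universal bases\<close>

instantiation "fun" :: (type, real_vector) real_vector
begin

definition scaleR_fun :: "real \<Rightarrow> ('a \<Rightarrow> 'b) \<Rightarrow> 'a \<Rightarrow> 'b"
  where "scaleR_fun c f = (\<lambda>x. c *\<^sub>R f x)"

instance
  by standard (simp_all add: scaleR_fun_def fun_eq_iff scaleR_add_right scaleR_add_left)

end

text \<open>
  The universal property ranges over all Banach space structures \<open>(V, N)\<close> on linear subspaces of
  the vector space of all real sequences, where \<open>N\<close> is an arbitrary complete norm on \<open>V\<close>, unrelated
  to the topology of \<open>nat \<Rightarrow> real\<close>. Up to linear isometry these include every separable Banach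
  space \<open>Y\<close>: if the continuous functionals \<open>f\<^sub>n\<close> separate the points of \<open>Y\<close>, then
  \<open>y \<mapsto> (f\<^sub>n(y))\<^sub>n\<close> is a linear injection.
\<close>

definition universal_unconditional_basis ::
    "'a::real_vector set \<Rightarrow> ('a \<Rightarrow> real) \<Rightarrow> (nat \<Rightarrow> 'a) \<Rightarrow> bool"
  where "universal_unconditional_basis U NU u \<longleftrightarrow>
    banach_space U NU \<and> separable_space (norm_topology U NU) \<and>
    schauder_basis U NU u \<and> unconditional U NU u \<and>
    (\<forall>(V :: (nat \<Rightarrow> real) set) N x.
       banach_space V N \<and> separable_space (norm_topology V N) \<and>
       basic_sequence V N x \<and> unconditional V N x \<longrightarrow>
       (\<exists>k :: nat \<Rightarrow> nat. strict_mono k \<and> equivalent_sequences V N x U NU (u \<circ> k)))"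

definition universal_schauder_basis ::
    "'a::real_vector set \<Rightarrow> ('a \<Rightarrow> real) \<Rightarrow> (nat \<Rightarrow> 'a) \<Rightarrow> bool"
  where "universal_schauder_basis U NU u \<longleftrightarrow>
    banach_space U NU \<and> separable_space (norm_topology U NU) \<and>
    schauder_basis U NU u \<and>
    (\<forall>(V :: (nat \<Rightarrow> real) set) N x.
       banach_space V N \<and> separable_space (norm_topology V N) \<and> basic_sequence V N x \<longrightarrow>
       (\<exists>k :: nat \<Rightarrow> nat. strict_mono k \<and> equivalent_sequences V N x U NU (u \<circ> k)))"


section \<open>The equivalence relations and Borel reducibility\<close>

definition coef_equiv ::
    "'a::real_vector set \<Rightarrow> ('a \<Rightarrow> real) \<Rightarrow> (nat \<Rightarrow> 'a) \<Rightarrow> ((nat \<Rightarrow> real) \<times> (nat \<Rightarrow> real)) set"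
  where "coef_equiv V N x = {(a, b). a - b \<in> coef V N x}"

text \<open>On \<open>nat \<Rightarrow> real\<close>, \<^const>\<open>borel\<close> refers to the product topology.\<close>

definition borel_reducible :: "('p::polish_space \<times> 'p) set \<Rightarrow> ('q::polish_space \<times> 'q) set \<Rightarrow> bool"
    (infix "\<le>\<^sub>B" 50)
  where "E \<le>\<^sub>B F \<longleftrightarrow>
    (\<exists>\<theta> \<in> borel_measurable borel. \<forall>x y. (x, y) \<in> E \<longleftrightarrow> (\<theta> x, \<theta> y) \<in> F)"


section \<open>Agreement with the type classes\<close>

lemma Metric_space_norm_metric:
  assumes "banach_space V N"
  shows "Metric_space V (norm_metric V N)"
proof
  have sub: "x - y \<in> V" if "x \<in> V" "y \<in> V" for x y
    using assms that by (simp add: banach_space_def subspace_diff)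
  have nonneg: "0 \<le> N x" and zero: "N x = 0 \<longleftrightarrow> x = 0" if "x \<in> V" for x
    using assms that by (simp_all add: banach_space_def)
  have triangle: "N (x + y) \<le> N x + N y" if "x \<in> V" "y \<in> V" for x y
    using assms that by (simp add: banach_space_def)
  have scale: "N (c *\<^sub>R x) = \<bar>c\<bar> * N x" if "x \<in> V" for c x
    using assms that by (simp add: banach_space_def)
  show "0 \<le> norm_metric V N x y" for x y
    by (simp add: norm_metric_def nonneg sub)
  show "norm_metric V N x y = norm_metric V N y x" for x y
    using scale[of "x - y" "-1"] sub[of x y] by (simp add: norm_metric_def)
  show "norm_metric V N x y = 0 \<longleftrightarrow> x = y" if "x \<in> V" "y \<in> V" for x y
    by (simp add: norm_metric_def zero sub that)
  show "norm_metric V N x z \<le> norm_metric V N x y + norm_metric V N y z"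
    if "x \<in> V" "y \<in> V" "z \<in> V" for x y z
    using triangle[of "x - y" "y - z"] by (simp add: norm_metric_def sub that)
qed

lemma norm_metric_UNIV: "norm_metric UNIV norm = (dist :: 'a::real_normed_vector \<Rightarrow> _)"
  by (simp add: norm_metric_def dist_norm fun_eq_iff)

lemma norm_topology_UNIV:
  "norm_topology UNIV norm = (euclidean :: 'a::real_normed_vector topology)"
  by (simp add: norm_topology_def norm_metric_UNIV)

lemma banach_space_UNIV: "banach_space UNIV (norm :: 'a::banach \<Rightarrow> real)"
  by (simp add: banach_space_def norm_metric_UNIV norm_triangle_ineq complete_UNIV)

lemma series_sums_UNIV:
  "series_sums UNIV norm f s \<longleftrightarrow> f sums (s :: 'a::real_normed_vector)"
  by (simp add: series_sums_def norm_topology_UNIV sums_def)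

lemma coef_UNIV:
  "coef UNIV norm x = {a. summable (\<lambda>n. a n *\<^sub>R (x n :: 'a::real_normed_vector))}"
  by (simp add: coef_def series_converges_def series_sums_UNIV summable_def)

end

theory Submission
  imports Defs
begin

text \<open>
  The relation \<^term>\<open>coef_equiv X N x\<close> depends only on the set \<^term>\<open>coef X N x\<close>. If this set equals
  the coefficient set of a subsequence \<open>u \<circ> k\<close> of the universal basis, then the reduction writes the
  \<open>n\<close>-th entry of a sequence at position \<open>k n\<close> and fills the other positions with zeros. This map is
  linear and continuous. The series of the spread sequence along \<open>u\<close> has the same partial sums, up to
  repetitions, as the series of the original sequence along \<open>u \<circ> k\<close>, so both converge or neither does
  (\<open>coef_equiv_reducible_to_subsequence\<close>).

  Such a subsequence is provided by universality only for basic sequences in Banach spaces whose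
  elements are real sequences, whereas \<open>X\<close> lives in an arbitrary vector space and need not be
  separable. So \<open>X\<close> is first replaced by a copy of the closed span \<open>Y\<close> of \<open>x\<close>. As \<open>x\<close> is a
  Schauder basis of \<open>Y\<close>, the map \<open>a \<mapsto> \<Sum>\<^sub>n a\<^sub>n x\<^sub>n\<close> is a linear bijection from the coefficient set
  onto \<open>Y\<close>; linearity and bijectivity are just the algebra of series and the existence and uniqueness
  of expansions. The norm of \<open>Y\<close> pulled back along it makes the coefficient set a Banach space in
  which the unit sequences play the role of \<open>x\<close>. The new space is separable, since the finite rational
  combinations of a Schauder basis are dense; the coefficient set and unconditionality carry over
  (\<open>basic_sequence_in_sequence_space\<close>).
\<close>

section \<open>Norms on linear subspaces\<close>

text \<open>
  Separating the norm axioms from completeness allows limits to be treated in a closed span before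
  that span is known to be complete.
\<close>

definition norm_on :: "'a::real_vector set \<Rightarrow> ('a \<Rightarrow> real) \<Rightarrow> bool"
  where "norm_on V N \<longleftrightarrow>
    subspace V \<and>
    (\<forall>x\<in>V. 0 \<le> N x) \<and>
    (\<forall>x\<in>V. N x = 0 \<longleftrightarrow> x = 0) \<and>
    (\<forall>x\<in>V. \<forall>y\<in>V. N (x + y) \<le> N x + N y) \<and>
    (\<forall>x\<in>V. \<forall>c. N (c *\<^sub>R x) = \<bar>c\<bar> * N x)"

lemma norm_on_subspace: "norm_on V N \<Longrightarrow> subspace V"
  and norm_on_nonneg: "norm_on V N \<Longrightarrow> x \<in> V \<Longrightarrow> 0 \<le> N x"
  and norm_on_eq_0_iff: "norm_on V N \<Longrightarrow> x \<in> V \<Longrightarrow> N x = 0 \<longleftrightarrow> x = 0"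
  and norm_on_triangle: "norm_on V N \<Longrightarrow> x \<in> V \<Longrightarrow> y \<in> V \<Longrightarrow> N (x + y) \<le> N x + N y"
  and norm_on_scaleR: "norm_on V N \<Longrightarrow> x \<in> V \<Longrightarrow> N (c *\<^sub>R x) = \<bar>c\<bar> * N x"
  by (simp_all add: norm_on_def)

lemma norm_on_minus_commute:
  assumes "norm_on V N" "x \<in> V" "y \<in> V"
  shows "N (x - y) = N (y - x)"
  using norm_on_scaleR[OF assms(1) subspace_diff[OF norm_on_subspace[OF assms(1)] assms(2,3)], of "-1"]
  by simp

lemma norm_on_triangle_diff:
  assumes "norm_on V N" "x \<in> V" "y \<in> V" "z \<in> V"
  shows "N (x - z) \<le> N (x - y) + N (y - z)"
  using norm_on_triangle[OF assms(1), of "x - y" "y - z"] assms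
  by (simp add: norm_on_subspace subspace_diff)

lemma norm_on_mono: "norm_on V N \<Longrightarrow> subspace W \<Longrightarrow> W \<subseteq> V \<Longrightarrow> norm_on W N"
  by (auto simp: norm_on_def subset_iff)

lemma Metric_space_norm_on:
  assumes "norm_on V N"
  shows "Metric_space V (norm_metric V N)"
proof
  note facts = norm_on_subspace[OF assms] norm_on_nonneg[OF assms] norm_on_eq_0_iff[OF assms]
  show "0 \<le> norm_metric V N x y" for x y
    by (simp add: norm_metric_def facts subspace_diff)
  show "norm_metric V N x y = norm_metric V N y x" for x y
    using norm_on_minus_commute[OF assms] by (simp add: norm_metric_def)
  show "norm_metric V N x y = 0 \<longleftrightarrow> x = y" if "x \<in> V" "y \<in> V" for x y
    by (simp add: norm_metric_def facts subspace_diff that)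
  show "norm_metric V N x z \<le> norm_metric V N x y + norm_metric V N y z"
    if "x \<in> V" "y \<in> V" "z \<in> V" for x y z
    using norm_on_triangle_diff[OF assms] that by (simp add: norm_metric_def)
qed

text \<open>
  \<^const>\<open>norm_metric\<close> vanishes as soon as one argument leaves \<open>V\<close>, so distances measure the norm only
  along sequences that stay in \<open>V\<close>. In exchange for that hypothesis, convergence becomes a statement
  about real limits, free of topologies.
\<close>

lemma limitin_norm_topology_iff:
  assumes "norm_on V N" "\<And>n. f n \<in> V"
  shows "limitin (norm_topology V N) f l F \<longleftrightarrow> l \<in> V \<and> ((\<lambda>n. N (f n - l)) \<longlongrightarrow> 0) F"
proof -
  interpret Metric_space V "norm_metric V N"
    by (rule Metric_space_norm_on[OF assms(1)])
  have "\<bar>N (f n - l)\<bar> = N (f n - l)" if "l \<in> V" for n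
    using assms that by (simp add: norm_on_nonneg norm_on_subspace subspace_diff)
  then show ?thesis
    by (auto simp: norm_topology_def limitin_metric norm_metric_def assms tendsto_iff)
qed

lemma norm_topology_limit_unique:
  assumes "norm_on V N"
    and "limitin (norm_topology V N) f l sequentially" "limitin (norm_topology V N) f m sequentially"
  shows "l = m"
proof -
  interpret Metric_space V "norm_metric V N"
    by (rule Metric_space_norm_on[OF assms(1)])
  show ?thesis
    using assms limitin_metric_unique[of f l sequentially m] by (simp add: norm_topology_def)
qed

lemma closure_of_norm_topology_iff:
  assumes "norm_on V N" "S \<subseteq> V"
  shows "y \<in> norm_topology V N closure_of S \<longleftrightarrow> y \<in> V \<and> (\<forall>\<epsilon>>0. \<exists>z\<in>S. N (z - y) < \<epsilon>)"
proof -
  interpret Metric_space V "norm_metric V N"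
    by (rule Metric_space_norm_on[OF assms(1)])
  have "z \<in> mball y r \<longleftrightarrow> N (z - y) < r" if "y \<in> V" "z \<in> S" for z r
    using that assms norm_on_minus_commute[of V N y z] by (auto simp: norm_metric_def)
  then show ?thesis
    by (auto simp: norm_topology_def metric_closure_of)
qed

lemma banach_space_iff:
  "banach_space V N \<longleftrightarrow> norm_on V N \<and>
    (\<forall>\<sigma>. (\<forall>n. \<sigma> n \<in> V) \<and> (\<forall>\<epsilon>>0. \<exists>K. \<forall>m\<ge>K. \<forall>n\<ge>K. N (\<sigma> m - \<sigma> n) < \<epsilon>) \<longrightarrow>
      (\<exists>l\<in>V. (\<lambda>n. N (\<sigma> n - l)) \<longlonglongrightarrow> 0))"
proof (cases "norm_on V N")
  case True
  interpret Metric_space V "norm_metric V N"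
    by (rule Metric_space_norm_on[OF True])
  have "MCauchy \<sigma> \<longleftrightarrow>
      (\<forall>n. \<sigma> n \<in> V) \<and> (\<forall>\<epsilon>>0. \<exists>K. \<forall>m\<ge>K. \<forall>n\<ge>K. N (\<sigma> m - \<sigma> n) < \<epsilon>)" for \<sigma>
    unfolding MCauchy_def norm_metric_def image_subset_iff by auto
  moreover have "(\<exists>l. limitin mtopology \<sigma> l sequentially) \<longleftrightarrow> (\<exists>l\<in>V. (\<lambda>n. N (\<sigma> n - l)) \<longlonglongrightarrow> 0)"
    if "\<forall>n. \<sigma> n \<in> V" for \<sigma>
    using limitin_norm_topology_iff[OF True, of \<sigma>] that by (auto simp: norm_topology_def)
  ultimately show ?thesis
    using True unfolding banach_space_def mcomplete_def norm_on_def by auto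
qed (auto simp: banach_space_def norm_on_def)

lemma banach_space_norm_on: "banach_space V N \<Longrightarrow> norm_on V N"
  by (simp add: banach_space_iff)

lemma banach_space_cauchy_limit:
  assumes "banach_space V N" "\<And>n. \<sigma> n \<in> V"
    and "\<forall>\<epsilon>>0. \<exists>K. \<forall>m\<ge>K. \<forall>n\<ge>K. N (\<sigma> m - \<sigma> n) < \<epsilon>"
  obtains l where "l \<in> V" "(\<lambda>n. N (\<sigma> n - l)) \<longlonglongrightarrow> 0"
  using assms that unfolding banach_space_iff by (elim conjE allE[of _ \<sigma>]) auto


section \<open>Series and closed spans\<close>

lemma series_sums_iff:
  assumes "norm_on V N" "\<And>i. f i \<in> V"
  shows "series_sums V N f s \<longleftrightarrow> s \<in> V \<and> (\<lambda>n. N ((\<Sum>i<n. f i) - s)) \<longlonglongrightarrow> 0"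
  unfolding series_sums_def
  by (rule limitin_norm_topology_iff[OF assms(1)])
    (intro subspace_sum[OF norm_on_subspace[OF assms(1)]] assms(2))

lemma series_sums_unique:
  assumes "norm_on V N" "series_sums V N f s" "series_sums V N f t"
  shows "s = t"
  using norm_topology_limit_unique[OF assms(1)] assms(2,3) unfolding series_sums_def by blast

lemma series_sums_add:
  assumes V: "norm_on V N" "\<And>i. f i \<in> V" "\<And>i. g i \<in> V"
    and "series_sums V N f s" "series_sums V N g t"
  shows "series_sums V N (\<lambda>i. f i + g i) (s + t)"
proof -
  note sub = norm_on_subspace[OF V(1)]
  have st: "s \<in> V" "t \<in> V" and
    lim: "(\<lambda>n. N ((\<Sum>i<n. f i) - s)) \<longlonglongrightarrow> 0" "(\<lambda>n. N ((\<Sum>i<n. g i) - t)) \<longlonglongrightarrow> 0"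
    using assms by (simp_all add: series_sums_iff)
  have mem: "(\<Sum>i<n. f i) - s \<in> V" "(\<Sum>i<n. g i) - t \<in> V" for n
    by (auto intro!: subspace_diff subspace_sum sub V st)
  have eq: "(\<Sum>i<n. f i + g i) - (s + t) = ((\<Sum>i<n. f i) - s) + ((\<Sum>i<n. g i) - t)" for n
    by (simp add: sum.distrib)
  have "(\<lambda>n. N ((\<Sum>i<n. f i + g i) - (s + t))) \<longlonglongrightarrow> 0"
  proof (rule tendsto_sandwich)
    show "\<forall>\<^sub>F n in sequentially. 0 \<le> N ((\<Sum>i<n. f i + g i) - (s + t))"
      unfolding eq using norm_on_nonneg[OF V(1)] subspace_add[OF sub] mem by (intro always_eventually) auto
    show "\<forall>\<^sub>F n in sequentially. N ((\<Sum>i<n. f i + g i) - (s + t))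
        \<le> N ((\<Sum>i<n. f i) - s) + N ((\<Sum>i<n. g i) - t)"
      unfolding eq using norm_on_triangle[OF V(1)] mem by (intro always_eventually) auto
    show "(\<lambda>n. N ((\<Sum>i<n. f i) - s) + N ((\<Sum>i<n. g i) - t)) \<longlonglongrightarrow> 0"
      using tendsto_add[OF lim] by simp
  qed simp
  then show ?thesis
    using V st sub by (simp add: series_sums_iff subspace_add)
qed

lemma series_sums_scaleR:
  assumes V: "norm_on V N" "\<And>i. f i \<in> V" and "series_sums V N f s"
  shows "series_sums V N (\<lambda>i. c *\<^sub>R f i) (c *\<^sub>R s)"
proof -
  note sub = norm_on_subspace[OF V(1)]
  have s: "s \<in> V" and lim: "(\<lambda>n. N ((\<Sum>i<n. f i) - s)) \<longlonglongrightarrow> 0"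
    using assms by (simp_all add: series_sums_iff)
  have "(\<Sum>i<n. f i) - s \<in> V" for n
    by (auto intro!: subspace_diff subspace_sum sub V s)
  then have "N ((\<Sum>i<n. c *\<^sub>R f i) - c *\<^sub>R s) = \<bar>c\<bar> * N ((\<Sum>i<n. f i) - s)" for n
    using norm_on_scaleR[OF V(1)] by (metis scaleR_right.sum scaleR_right_diff_distrib)
  then show ?thesis
    using V s sub tendsto_mult_left[OF lim, of "\<bar>c\<bar>"] by (simp add: series_sums_iff subspace_scale)
qed

lemma range_subset_closed_span:
  assumes "norm_on X N" "range x \<subseteq> X"
  shows "range x \<subseteq> closed_span X N x" "closed_span X N x \<subseteq> X"
proof -
  have "span (range x) \<subseteq> X"
    using assms by (simp add: span_minimal norm_on_subspace)
  then have "y \<in> closed_span X N x" if "y \<in> range x" for y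
    using closure_of_norm_topology_iff[OF assms(1)] assms that norm_on_eq_0_iff[OF assms(1), of 0]
    unfolding closed_span_def by (auto intro!: bexI[of _ y] simp: span_base norm_on_subspace subspace_0)
  then show "range x \<subseteq> closed_span X N x" ..
  show "closed_span X N x \<subseteq> X"
    using \<open>span (range x) \<subseteq> X\<close> closure_of_norm_topology_iff[OF assms(1)]
    unfolding closed_span_def by blast
qed

lemma closed_span_iff:
  assumes "norm_on X N" "range x \<subseteq> X"
  shows "y \<in> closed_span X N x \<longleftrightarrow> y \<in> X \<and> (\<forall>\<epsilon>>0. \<exists>z\<in>span (range x). N (z - y) < \<epsilon>)"
  unfolding closed_span_def
  using assms by (intro closure_of_norm_topology_iff) (simp_all add: span_minimal norm_on_subspace)

text \<open>
  Closedness of the closed span in sequential form; it makes completeness and convergence of series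
  pass from the ambient space to the closed span.
\<close>

lemma closed_span_limit:
  assumes "norm_on X N" "range x \<subseteq> X" "l \<in> X"
    and "\<And>n. f n \<in> closed_span X N x" "(\<lambda>n. N (f n - l)) \<longlonglongrightarrow> 0"
  shows "l \<in> closed_span X N x"
  unfolding closed_span_iff[OF assms(1,2)]
proof (intro conjI allI impI)
  fix \<epsilon> :: real
  assume "\<epsilon> > 0"
  then have "\<forall>\<^sub>F n in sequentially. N (f n - l) < \<epsilon> / 2"
    using order_tendstoD(2)[OF assms(5), of "\<epsilon> / 2"] by simp
  then obtain n where n: "N (f n - l) < \<epsilon> / 2"
    by (auto simp: eventually_sequentially)
  obtain z where z: "z \<in> span (range x)" "N (z - f n) < \<epsilon> / 2" and "f n \<in> X"
    using assms(4)[of n] \<open>\<epsilon> > 0\<close> half_gt_zero unfolding closed_span_iff[OF assms(1,2)] by blast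
  moreover have "z \<in> X"
    using z span_minimal[OF assms(2) norm_on_subspace[OF assms(1)]] by blast
  ultimately have "N (z - l) < \<epsilon>"
    using norm_on_triangle_diff[OF assms(1), of z "f n" l] n assms(3) by simp
  then show "\<exists>z\<in>span (range x). N (z - l) < \<epsilon>"
    using z by blast
qed (fact assms(3))

lemma subspace_closed_span:
  assumes "norm_on X N" "range x \<subseteq> X"
  shows "subspace (closed_span X N x)"
proof -
  note sub = norm_on_subspace[OF assms(1)]
  have inX: "z \<in> X" if "z \<in> span (range x)" for z
    using that span_minimal[OF assms(2) sub] by blast
  show ?thesis
    unfolding subspace_def
  proof (intro conjI ballI allI)
    show "0 \<in> closed_span X N x"
      unfolding closed_span_iff[OF assms]
      using norm_on_eq_0_iff[OF assms(1), of 0] sub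
      by (auto intro!: bexI[of _ 0] simp: span_zero subspace_0)
  next
    fix y y' assume "y \<in> closed_span X N x" "y' \<in> closed_span X N x"
    then have y: "y \<in> X" "\<And>\<epsilon>. \<epsilon> > 0 \<Longrightarrow> \<exists>z\<in>span (range x). N (z - y) < \<epsilon>"
      and y': "y' \<in> X" "\<And>\<epsilon>. \<epsilon> > 0 \<Longrightarrow> \<exists>z\<in>span (range x). N (z - y') < \<epsilon>"
      unfolding closed_span_iff[OF assms] by auto
    show "y + y' \<in> closed_span X N x"
      unfolding closed_span_iff[OF assms]
    proof (intro conjI allI impI)
      fix \<epsilon> :: real assume "\<epsilon> > 0"
      then obtain z z' where z: "z \<in> span (range x)" "N (z - y) < \<epsilon> / 2"
        and z': "z' \<in> span (range x)" "N (z' - y') < \<epsilon> / 2"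
        using y(2)[of "\<epsilon> / 2"] y'(2)[of "\<epsilon> / 2"] by auto
      have "N ((z - y) + (z' - y')) \<le> N (z - y) + N (z' - y')"
        using y(1) y'(1) z(1) z'(1) by (intro norm_on_triangle[OF assms(1)] subspace_diff[OF sub]) (simp_all add: inX)
      then have "N ((z + z') - (y + y')) < \<epsilon>"
        using z(2) z'(2) by (simp add: algebra_simps)
      then show "\<exists>w\<in>span (range x). N (w - (y + y')) < \<epsilon>"
        using span_add[OF z(1) z'(1)] by blast
    qed (use y y' sub in \<open>simp add: subspace_add\<close>)
  next
    fix c y assume "y \<in> closed_span X N x"
    then have y: "y \<in> X" "\<And>\<epsilon>. \<epsilon> > 0 \<Longrightarrow> \<exists>z\<in>span (range x). N (z - y) < \<epsilon>"
      unfolding closed_span_iff[OF assms] by auto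
    show "c *\<^sub>R y \<in> closed_span X N x"
      unfolding closed_span_iff[OF assms]
    proof (intro conjI allI impI)
      fix \<epsilon> :: real assume "\<epsilon> > 0"
      \<comment> \<open>The summand \<open>1\<close> covers the case \<open>c = 0\<close>.\<close>
      then obtain z where z: "z \<in> span (range x)" "N (z - y) < \<epsilon> / (\<bar>c\<bar> + 1)"
        using y(2)[of "\<epsilon> / (\<bar>c\<bar> + 1)"] by auto
      have zy: "z - y \<in> X"
        using y(1) z(1) by (intro subspace_diff[OF sub]) (simp_all add: inX)
      have "N (c *\<^sub>R z - c *\<^sub>R y) = \<bar>c\<bar> * N (z - y)"
        using norm_on_scaleR[OF assms(1) zy, of c] by (simp add: scaleR_right_diff_distrib)
      also have "\<dots> \<le> (\<bar>c\<bar> + 1) * N (z - y)"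
        using norm_on_nonneg[OF assms(1) zy] by (simp add: mult_right_mono)
      also have "\<dots> < \<epsilon>"
        using z(2) by (simp add: field_simps)
      finally show "\<exists>w\<in>span (range x). N (w - c *\<^sub>R y) < \<epsilon>"
        using span_scale[OF z(1)] by blast
    qed (use y sub in \<open>simp add: subspace_scale\<close>)
  qed
qed

lemma norm_on_closed_span:
  "norm_on X N \<Longrightarrow> range x \<subseteq> X \<Longrightarrow> norm_on (closed_span X N x) N"
  by (rule norm_on_mono[OF _ subspace_closed_span range_subset_closed_span(2)])

lemma banach_space_closed_span:
  fixes X :: "'a::real_vector set"
  assumes "banach_space X N" "range x \<subseteq> X"
  shows "banach_space (closed_span X N x) N"
proof -
  note X = banach_space_norm_on[OF assms(1)]
  note sub = range_subset_closed_span(2)[OF X assms(2)]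
  show ?thesis
    unfolding banach_space_iff
  proof (intro conjI allI impI; (elim conjE)?)
    fix \<sigma> :: "nat \<Rightarrow> 'a" assume \<sigma>: "\<forall>n. \<sigma> n \<in> closed_span X N x"
      and cauchy: "\<forall>\<epsilon>>0. \<exists>K. \<forall>m\<ge>K. \<forall>n\<ge>K. N (\<sigma> m - \<sigma> n) < \<epsilon>"
    have "\<sigma> n \<in> X" for n
      using \<sigma> sub by auto
    from banach_space_cauchy_limit[OF assms(1) this cauchy]
    obtain l where l: "l \<in> X" "(\<lambda>n. N (\<sigma> n - l)) \<longlonglongrightarrow> 0" .
    then show "\<exists>l\<in>closed_span X N x. (\<lambda>n. N (\<sigma> n - l)) \<longlonglongrightarrow> 0"
      using closed_span_limit[OF X assms(2) l(1) _ l(2)] \<sigma> by auto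
  qed (rule norm_on_closed_span[OF X assms(2)])
qed

lemma series_sums_closed_span_iff:
  assumes X: "norm_on X N" "range x \<subseteq> X" and f: "\<And>i. f i \<in> closed_span X N x"
  shows "series_sums (closed_span X N x) N f s \<longleftrightarrow> series_sums X N f s"
proof -
  note sub = range_subset_closed_span(2)[OF X]
  have "(\<Sum>i<n. f i) \<in> closed_span X N x" for n
    by (intro subspace_sum[OF subspace_closed_span[OF X]] f)
  then have "s \<in> closed_span X N x" if "s \<in> X" "(\<lambda>n. N ((\<Sum>i<n. f i) - s)) \<longlonglongrightarrow> 0"
    using closed_span_limit[OF X that(1) _ that(2)] by simp
  then show ?thesis
    using sub f by (auto simp: series_sums_iff[OF norm_on_closed_span[OF X]]
        series_sums_iff[OF X(1), of f] subset_iff)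
qed

lemma scaleR_in_closed_span:
  assumes X: "norm_on X N" "range x \<subseteq> X"
  shows "c *\<^sub>R x i \<in> closed_span X N x"
  by (intro subspace_scale[OF subspace_closed_span[OF X]] subsetD[OF range_subset_closed_span(1)[OF X]])
    simp

text \<open>The index map \<open>\<pi>\<close> covers both the series itself and its rearrangements.\<close>

lemma series_converges_closed_span_iff:
  assumes X: "norm_on X N" "range x \<subseteq> X"
  shows "series_converges (closed_span X N x) N (\<lambda>n. a n *\<^sub>R x (\<pi> n)) \<longleftrightarrow>
    series_converges X N (\<lambda>n. a n *\<^sub>R x (\<pi> n))"
proof -
  have "series_sums (closed_span X N x) N (\<lambda>n. a n *\<^sub>R x (\<pi> n)) s \<longleftrightarrow>
      series_sums X N (\<lambda>n. a n *\<^sub>R x (\<pi> n)) s" for s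
    by (rule series_sums_closed_span_iff[OF X]) (rule scaleR_in_closed_span[OF X])
  then show ?thesis
    by (simp add: series_converges_def)
qed

lemma coef_closed_span:
  "norm_on X N \<Longrightarrow> range x \<subseteq> X \<Longrightarrow> coef (closed_span X N x) N x = coef X N x"
  unfolding coef_def using series_converges_closed_span_iff[of X N x _ "\<lambda>n. n"] by simp

lemma unconditional_closed_span:
  assumes "norm_on X N" "range x \<subseteq> X" "unconditional X N x"
  shows "unconditional (closed_span X N x) N x"
  using assms series_converges_closed_span_iff[OF assms(1,2), of "a \<circ> \<pi>" \<pi> for a \<pi>]
  by (simp add: unconditional_def coef_closed_span)


section \<open>Spaces with a Schauder basis\<close>

lemma schauder_basis_partial_sum_approximation:
  assumes V: "norm_on V N" and x: "schauder_basis V N x" and "v \<in> V" and "\<epsilon> > 0"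
  shows "\<exists>a n. N ((\<Sum>i<n. a i *\<^sub>R x i) - v) < \<epsilon>"
proof -
  note sub = norm_on_subspace[OF V]
  obtain a where "series_sums V N (\<lambda>n. a n *\<^sub>R x n) v"
    using x \<open>v \<in> V\<close> unfolding schauder_basis_def by blast
  moreover have "x i \<in> V" for i
    using x by (auto simp: schauder_basis_def)
  ultimately have "(\<lambda>n. N ((\<Sum>i<n. a i *\<^sub>R x i) - v)) \<longlonglongrightarrow> 0"
    by (simp add: series_sums_iff[OF V] subspace_scale[OF sub])
  from order_tendstoD(2)[OF this \<open>\<epsilon> > 0\<close>] show ?thesis
    by (auto simp: eventually_sequentially)
qed

lemma basic_sequence_of_schauder_basis:
  assumes V: "norm_on V N" and x: "schauder_basis V N x"
  shows "basic_sequence V N x"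
proof -
  have range: "range x \<subseteq> V"
    using x by (simp add: schauder_basis_def)
  have "v \<in> closed_span V N x" if "v \<in> V" for v
    unfolding closed_span_iff[OF V range]
  proof (intro conjI allI impI)
    fix \<epsilon> :: real assume "\<epsilon> > 0"
    then obtain a n where "N ((\<Sum>i<n. a i *\<^sub>R x i) - v) < \<epsilon>"
      using schauder_basis_partial_sum_approximation[OF V x \<open>v \<in> V\<close>] by blast
    then show "\<exists>z\<in>span (range x). N (z - v) < \<epsilon>"
      by (intro bexI[of _ "\<Sum>i<n. a i *\<^sub>R x i"] span_sum span_scale span_base) simp_all
  qed (fact that)
  then have "closed_span V N x = V"
    using range_subset_closed_span(2)[OF V range] by blast
  then show ?thesis
    using x range by (simp add: basic_sequence_def)
qed

text \<open>
  The coefficients are replaced by rational ones one at a time, halving the permitted error for each.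
  Lists of rationals encode the combinations because there are only countably many of them.
\<close>

lemma rational_approximation:
  assumes V: "norm_on V N" and x: "\<And>i. x i \<in> V" and "\<epsilon> > 0"
  shows "\<exists>qs :: rat list. length qs = n \<and>
    N ((\<Sum>i<n. of_rat (qs ! i) *\<^sub>R x i) - (\<Sum>i<n. a i *\<^sub>R x i)) < \<epsilon>"
  using \<open>\<epsilon> > 0\<close>
proof (induction n arbitrary: \<epsilon>)
  case 0
  then show ?case
    using norm_on_eq_0_iff[OF V, of 0] by (simp add: norm_on_subspace[OF V] subspace_0)
next
  case (Suc n)
  note sub = norm_on_subspace[OF V]
  obtain qs :: "rat list" where qs: "length qs = n"
    "N ((\<Sum>i<n. of_rat (qs ! i) *\<^sub>R x i) - (\<Sum>i<n. a i *\<^sub>R x i)) < \<epsilon> / 2"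
    using Suc.IH[of "\<epsilon> / 2"] Suc.prems by auto
  have pos: "N (x n) + 1 > 0"
    using norm_on_nonneg[OF V x[of n]] by simp
  \<comment> \<open>The summand \<open>1\<close> keeps the denominator positive when \<open>x n = 0\<close>.\<close>
  obtain q where q: "a n < of_rat q" "of_rat q < a n + \<epsilon> / 2 / (N (x n) + 1)"
    using of_rat_dense[of "a n" "a n + \<epsilon> / 2 / (N (x n) + 1)"] Suc.prems pos by auto
  have "N ((of_rat q - a n) *\<^sub>R x n) = \<bar>of_rat q - a n\<bar> * N (x n)"
    by (rule norm_on_scaleR[OF V x])
  also have "\<dots> \<le> (of_rat q - a n) * (N (x n) + 1)"
    using q(1) by (simp add: mult_left_mono)
  also have "\<dots> < \<epsilon> / 2 / (N (x n) + 1) * (N (x n) + 1)"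
    using q(2) pos by (intro mult_strict_right_mono) simp_all
  also have "\<dots> = \<epsilon> / 2"
    using pos by (intro nonzero_eq_divide_eq[THEN iffD1]) simp_all
  finally have last: "N ((of_rat q - a n) *\<^sub>R x n) < \<epsilon> / 2" .
  have "(\<Sum>i<Suc n. of_rat ((qs @ [q]) ! i) *\<^sub>R x i) - (\<Sum>i<Suc n. a i *\<^sub>R x i)
      = ((\<Sum>i<n. of_rat (qs ! i) *\<^sub>R x i) - (\<Sum>i<n. a i *\<^sub>R x i)) + (of_rat q - a n) *\<^sub>R x n"
    using qs(1) by (simp add: nth_append algebra_simps)
  also have "N \<dots> \<le> N ((\<Sum>i<n. of_rat (qs ! i) *\<^sub>R x i) - (\<Sum>i<n. a i *\<^sub>R x i))
      + N ((of_rat q - a n) *\<^sub>R x n)"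
    by (intro norm_on_triangle[OF V] subspace_diff[OF sub] subspace_sum[OF sub] subspace_scale[OF sub] x)
  also have "\<dots> < \<epsilon>"
    using qs(2) last by simp
  finally show ?case
    using qs(1) by (intro exI[of _ "qs @ [q]"]) simp
qed

lemma separable_of_schauder_basis:
  assumes V: "norm_on V N" and x: "schauder_basis V N x"
  shows "separable_space (norm_topology V N)"
proof -
  note sub = norm_on_subspace[OF V]
  have xV: "x i \<in> V" for i
    using x by (auto simp: schauder_basis_def)
  define C where "C = range (\<lambda>qs :: rat list. \<Sum>i<length qs. of_rat (qs ! i) *\<^sub>R x i)"
  have CV: "C \<subseteq> V"
    unfolding C_def by (auto intro!: subspace_sum[OF sub] subspace_scale[OF sub] xV)
  have "v \<in> norm_topology V N closure_of C" if "v \<in> V" for v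
    unfolding closure_of_norm_topology_iff[OF V CV]
  proof (intro conjI allI impI)
    fix \<epsilon> :: real assume "\<epsilon> > 0"
    then obtain a n where a: "N ((\<Sum>i<n. a i *\<^sub>R x i) - v) < \<epsilon> / 2"
      using schauder_basis_partial_sum_approximation[OF V x \<open>v \<in> V\<close>, of "\<epsilon> / 2"] by auto
    obtain qs :: "rat list" where qs: "length qs = n"
      "N ((\<Sum>i<n. of_rat (qs ! i) *\<^sub>R x i) - (\<Sum>i<n. a i *\<^sub>R x i)) < \<epsilon> / 2"
      using rational_approximation[of V N x "\<epsilon> / 2" n a, OF V xV] \<open>\<epsilon> > 0\<close> by auto
    have mem: "(\<Sum>i<n. b i *\<^sub>R x i) \<in> V" for b :: "nat \<Rightarrow> real"
      by (intro subspace_sum[OF sub] subspace_scale[OF sub] xV)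
    have "N ((\<Sum>i<n. of_rat (qs ! i) *\<^sub>R x i) - v) < \<epsilon>"
      using norm_on_triangle_diff[OF V mem mem that, of "\<lambda>i. of_rat (qs ! i)" a] a qs(2) by simp
    then show "\<exists>z\<in>C. N (z - v) < \<epsilon>"
      unfolding C_def using qs(1) by blast
  qed (fact that)
  moreover have "topspace (norm_topology V N) = V"
    unfolding norm_topology_def by (rule Metric_space.topspace_mtopology[OF Metric_space_norm_on[OF V]])
  moreover have "countable C"
    unfolding C_def by simp
  ultimately show ?thesis
    unfolding separable_space_def using CV closure_of_subset_topspace[of "norm_topology V N" C]
    by (intro exI[of _ C]) auto
qed


section \<open>Pulling a norm back along a linear bijection\<close>

text \<open>
  Linearity is required on \<open>V\<close> only: a map defined as the sum of a series carries no information at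
  points where the series diverges.
\<close>

definition linear_bij_betw :: "('a::real_vector \<Rightarrow> 'b::real_vector) \<Rightarrow> 'a set \<Rightarrow> 'b set \<Rightarrow> bool"
  where "linear_bij_betw S V Y \<longleftrightarrow>
    subspace V \<and> bij_betw S V Y \<and>
    (\<forall>a\<in>V. \<forall>b\<in>V. S (a + b) = S a + S b) \<and> (\<forall>a\<in>V. \<forall>c. S (c *\<^sub>R a) = c *\<^sub>R S a)"

lemma
  assumes "linear_bij_betw S V Y"
  shows linear_bij_subspace: "subspace V"
    and linear_bij_bij: "bij_betw S V Y"
    and linear_bij_add: "a \<in> V \<Longrightarrow> b \<in> V \<Longrightarrow> S (a + b) = S a + S b"
    and linear_bij_scaleR: "a \<in> V \<Longrightarrow> S (c *\<^sub>R a) = c *\<^sub>R S a"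
    and linear_bij_mem: "a \<in> V \<Longrightarrow> S a \<in> Y"
  using assms bij_betwE[of S V Y] by (auto simp: linear_bij_betw_def)

lemma linear_bij_0: "linear_bij_betw S V Y \<Longrightarrow> S 0 = 0"
  using linear_bij_scaleR[of S V Y 0 0] linear_bij_subspace[of S V Y] by (simp add: subspace_0)

lemma linear_bij_diff:
  assumes "linear_bij_betw S V Y" "a \<in> V" "b \<in> V"
  shows "S (a - b) = S a - S b"
  using linear_bij_add[OF assms(1,2), of "(-1) *\<^sub>R b"] linear_bij_scaleR[OF assms(1,3), of "-1"]
    subspace_scale[OF linear_bij_subspace[OF assms(1)] assms(3), of "-1"]
  by simp

lemma linear_bij_sum:
  assumes "linear_bij_betw S V Y" "\<And>i. f i \<in> V"
  shows "S (\<Sum>i<n. f i) = (\<Sum>i<n::nat. S (f i))"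
proof (induction n)
  case (Suc n)
  have "(\<Sum>i<n. f i) \<in> V"
    by (intro subspace_sum[OF linear_bij_subspace[OF assms(1)]] assms(2))
  then show ?case
    using Suc linear_bij_add[OF assms(1)] assms(2) by simp
qed (simp add: linear_bij_0[OF assms(1)])

lemma norm_on_pullback:
  assumes S: "linear_bij_betw S V Y" and Y: "norm_on Y N"
  shows "norm_on V (\<lambda>a. N (S a))"
proof -
  have "S a = 0 \<longleftrightarrow> a = 0" if "a \<in> V" for a
    using that linear_bij_bij[OF S] linear_bij_0[OF S] subspace_0[OF linear_bij_subspace[OF S]]
    by (metis bij_betw_imp_inj_on inj_on_eq_iff)
  then show ?thesis
    using linear_bij_subspace[OF S] linear_bij_add[OF S] linear_bij_scaleR[OF S] linear_bij_mem[OF S] Y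
    by (simp add: norm_on_def)
qed

lemma banach_space_pullback:
  fixes V :: "'a::real_vector set"
  assumes S: "linear_bij_betw S V Y" and Y: "banach_space Y N"
  shows "banach_space V (\<lambda>a. N (S a))"
  unfolding banach_space_iff
proof (intro conjI allI impI; (elim conjE)?)
  fix \<sigma> :: "nat \<Rightarrow> 'a" assume \<sigma>: "\<forall>n. \<sigma> n \<in> V"
    and cauchy: "\<forall>\<epsilon>>0. \<exists>K. \<forall>m\<ge>K. \<forall>n\<ge>K. N (S (\<sigma> m - \<sigma> n)) < \<epsilon>"
  have "\<forall>n. S (\<sigma> n) \<in> Y" "\<forall>\<epsilon>>0. \<exists>K. \<forall>m\<ge>K. \<forall>n\<ge>K. N (S (\<sigma> m) - S (\<sigma> n)) < \<epsilon>"
    using \<sigma> cauchy linear_bij_diff[OF S] linear_bij_mem[OF S] by simp_all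
  then obtain y where y: "y \<in> Y" "(\<lambda>n. N (S (\<sigma> n) - y)) \<longlonglongrightarrow> 0"
    using banach_space_cauchy_limit[OF Y, of "\<lambda>n. S (\<sigma> n)"] by blast
  then obtain l where "l \<in> V" "y = S l"
    using linear_bij_bij[OF S] by (auto simp: bij_betw_def)
  then show "\<exists>l\<in>V. (\<lambda>n. N (S (\<sigma> n - l))) \<longlonglongrightarrow> 0"
    using y \<sigma> linear_bij_diff[OF S] by auto
qed (rule norm_on_pullback[OF S banach_space_norm_on[OF Y]])

lemma series_sums_pullback:
  assumes S: "linear_bij_betw S V Y" and Y: "norm_on Y N" and "\<And>i. f i \<in> V" "a \<in> V"
  shows "series_sums V (\<lambda>a. N (S a)) f a \<longleftrightarrow> series_sums Y N (\<lambda>i. S (f i)) (S a)"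
proof -
  have "(\<Sum>i<n. f i) \<in> V" for n
    by (intro subspace_sum[OF linear_bij_subspace[OF S]] assms(3))
  then show ?thesis
    using assms linear_bij_diff[OF S] linear_bij_sum[OF S] linear_bij_mem[OF S]
    by (simp add: series_sums_iff[OF Y] series_sums_iff[OF norm_on_pullback[OF S Y]])
qed

lemma series_converges_pullback:
  assumes S: "linear_bij_betw S V Y" and Y: "norm_on Y N" and f: "\<And>i. f i \<in> V"
  shows "series_converges V (\<lambda>a. N (S a)) f \<longleftrightarrow> series_converges Y N (\<lambda>i. S (f i))"
proof
  assume "series_converges V (\<lambda>a. N (S a)) f"
  then obtain a where a: "series_sums V (\<lambda>a. N (S a)) f a"
    by (auto simp: series_converges_def)
  then have "a \<in> V"
    using series_sums_iff[of V "\<lambda>a. N (S a)" f a] norm_on_pullback[OF S Y] f by simp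
  then show "series_converges Y N (\<lambda>i. S (f i))"
    using a series_sums_pullback[of S V Y N f a, OF S Y f] by (auto simp: series_converges_def)
next
  assume "series_converges Y N (\<lambda>i. S (f i))"
  then obtain s where s: "series_sums Y N (\<lambda>i. S (f i)) s"
    by (auto simp: series_converges_def)
  then have "s \<in> Y"
    using series_sums_iff[of Y N "\<lambda>i. S (f i)" s] Y linear_bij_mem[OF S f] by simp
  then obtain a where "a \<in> V" "s = S a"
    using linear_bij_bij[OF S] by (auto simp: bij_betw_def)
  then show "series_converges V (\<lambda>a. N (S a)) f"
    using s series_sums_pullback[of S V Y N f a, OF S Y f] by (auto simp: series_converges_def)
qed

lemma
  assumes S: "linear_bij_betw S V Y" and Y: "norm_on Y N" and e: "\<And>i. e i \<in> V"
  shows coef_pullback: "coef V (\<lambda>a. N (S a)) e = coef Y N (\<lambda>i. S (e i))"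
    and unconditional_pullback:
      "unconditional V (\<lambda>a. N (S a)) e \<longleftrightarrow> unconditional Y N (\<lambda>i. S (e i))"
    and schauder_basis_pullback:
      "schauder_basis V (\<lambda>a. N (S a)) e \<longleftrightarrow> schauder_basis Y N (\<lambda>i. S (e i))"
proof -
  have mem: "c *\<^sub>R e i \<in> V" for c i
    using e by (intro subspace_scale[OF linear_bij_subspace[OF S]])
  have scale: "S (c *\<^sub>R e i) = c *\<^sub>R S (e i)" for c i
    by (rule linear_bij_scaleR[OF S e])
  have conv: "series_converges V (\<lambda>a. N (S a)) (\<lambda>n. a n *\<^sub>R e (\<pi> n)) \<longleftrightarrow>
      series_converges Y N (\<lambda>n. a n *\<^sub>R S (e (\<pi> n)))" for a :: "nat \<Rightarrow> real" and \<pi>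
    using series_converges_pullback[OF S Y, of "\<lambda>n. a n *\<^sub>R e (\<pi> n)"] mem by (simp add: scale)
  show coef: "coef V (\<lambda>a. N (S a)) e = coef Y N (\<lambda>i. S (e i))"
    unfolding coef_def using conv[of _ "\<lambda>n. n"] by simp
  show "unconditional V (\<lambda>a. N (S a)) e \<longleftrightarrow> unconditional Y N (\<lambda>i. S (e i))"
    unfolding unconditional_def coef using conv[of "\<lambda>n. a (\<pi> n)" \<pi> for a \<pi>] by simp
  have "series_sums V (\<lambda>a. N (S a)) (\<lambda>n. b n *\<^sub>R e n) a \<longleftrightarrow>
      series_sums Y N (\<lambda>n. b n *\<^sub>R S (e n)) (S a)" if "a \<in> V" for a b
    using series_sums_pullback[OF S Y, of "\<lambda>n. b n *\<^sub>R e n" a] mem that by (simp add: scale)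
  moreover have "(\<forall>y\<in>Y. P y) \<longleftrightarrow> (\<forall>a\<in>V. P (S a))" for P
    using linear_bij_bij[OF S] by (auto simp: bij_betw_def)
  ultimately show "schauder_basis V (\<lambda>a. N (S a)) e \<longleftrightarrow> schauder_basis Y N (\<lambda>i. S (e i))"
    unfolding schauder_basis_def using e linear_bij_mem[OF S e] by (simp add: image_subset_iff)
qed


section \<open>The coefficient space of a basic sequence\<close>

definition unit_sequence :: "nat \<Rightarrow> nat \<Rightarrow> real"
  where "unit_sequence n = (\<lambda>i. if i = n then 1 else 0)"

definition basis_sum :: "'a::real_vector set \<Rightarrow> ('a \<Rightarrow> real) \<Rightarrow> (nat \<Rightarrow> 'a) \<Rightarrow> (nat \<Rightarrow> real) \<Rightarrow> 'a"
  where "basis_sum Y N x a = (THE s. series_sums Y N (\<lambda>n. a n *\<^sub>R x n) s)"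

lemma basis_sum_eq:
  "norm_on Y N \<Longrightarrow> series_sums Y N (\<lambda>n. a n *\<^sub>R x n) s \<Longrightarrow> basis_sum Y N x a = s"
  unfolding basis_sum_def by (blast intro: series_sums_unique)

lemma series_sums_basis_sum:
  "norm_on Y N \<Longrightarrow> a \<in> coef Y N x \<Longrightarrow> series_sums Y N (\<lambda>n. a n *\<^sub>R x n) (basis_sum Y N x a)"
  using basis_sum_eq by (fastforce simp: coef_def series_converges_def)

lemma series_sums_unit_sequence:
  assumes Y: "norm_on Y N" and x: "\<And>i. x i \<in> Y"
  shows "series_sums Y N (\<lambda>i. unit_sequence n i *\<^sub>R x i) (x n)"
proof -
  note sub = norm_on_subspace[OF Y]
  have "(\<Sum>i<m. unit_sequence n i *\<^sub>R x i) = x n" if "m > n" for m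
  proof -
    have "(\<Sum>i<m. unit_sequence n i *\<^sub>R x i) = (\<Sum>i<m. if i = n then x n else 0)"
      by (rule sum.cong) (simp_all add: unit_sequence_def)
    then show ?thesis
      using that by simp
  qed
  then have "\<forall>\<^sub>F m in sequentially. N ((\<Sum>i<m. unit_sequence n i *\<^sub>R x i) - x n) = 0"
    using norm_on_eq_0_iff[OF Y subspace_0[OF sub]]
    by (intro eventually_mono[OF eventually_gt_at_top[of n]]) simp
  then show ?thesis
    using x subspace_scale[OF sub] by (simp add: series_sums_iff[OF Y] tendsto_eventually)
qed

text \<open>
  Existence of expansions gives surjectivity and their uniqueness gives injectivity. The image stays
  in \<open>Y\<close> because limits in \<^term>\<open>norm_topology Y N\<close> are elements of \<open>Y\<close>.
\<close>

lemma linear_bij_basis_sum: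
  assumes Y: "norm_on Y N" and x: "schauder_basis Y N x"
  shows "linear_bij_betw (basis_sum Y N x) (coef Y N x) Y"
proof -
  note sub = norm_on_subspace[OF Y]
  note sums = series_sums_basis_sum[OF Y]
  have xY: "x i \<in> Y" for i
    using x by (auto simp: schauder_basis_def)
  then have mem: "c *\<^sub>R x i \<in> Y" for c i
    by (intro subspace_scale[OF sub])
  have inY: "s \<in> Y" if "series_sums Y N (\<lambda>n. a n *\<^sub>R x n) s" for a s
    using that by (simp add: series_sums_iff[OF Y mem])
  have coefI: "a \<in> coef Y N x" if "series_sums Y N (\<lambda>n. a n *\<^sub>R x n) s" for a s
    using that by (auto simp: coef_def series_converges_def)
  have add: "series_sums Y N (\<lambda>n. (a + b) n *\<^sub>R x n) (basis_sum Y N x a + basis_sum Y N x b)"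
    if "a \<in> coef Y N x" "b \<in> coef Y N x" for a b
    using series_sums_add[OF Y mem mem sums[OF that(1)] sums[OF that(2)]]
    by (simp add: scaleR_add_left)
  have scale: "series_sums Y N (\<lambda>n. (c *\<^sub>R a) n *\<^sub>R x n) (c *\<^sub>R basis_sum Y N x a)"
    if "a \<in> coef Y N x" for a c
    using series_sums_scaleR[OF Y mem sums[OF that], of c] by (simp add: scaleR_fun_def)
  have "series_sums Y N (\<lambda>n. (0::nat \<Rightarrow> real) n *\<^sub>R x n) 0"
    using subspace_0[OF sub] norm_on_eq_0_iff[OF Y, of 0] by (simp add: series_sums_iff[OF Y])
  then have "subspace (coef Y N x)"
    unfolding subspace_def using coefI add scale by blast
  moreover have "inj_on (basis_sum Y N x) (coef Y N x)"
  proof (rule inj_onI)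
    fix a b assume ab: "a \<in> coef Y N x" "b \<in> coef Y N x" "basis_sum Y N x a = basis_sum Y N x b"
    then show "a = b"
      using sums[OF ab(1)] sums[OF ab(2)] inY x unfolding schauder_basis_def by metis
  qed
  moreover have "basis_sum Y N x ` coef Y N x = Y"
  proof
    show "basis_sum Y N x ` coef Y N x \<subseteq> Y"
      using sums inY by blast
    show "Y \<subseteq> basis_sum Y N x ` coef Y N x"
    proof
      fix y assume "y \<in> Y"
      then obtain a where a: "series_sums Y N (\<lambda>n. a n *\<^sub>R x n) y"
        using x unfolding schauder_basis_def by blast
      then show "y \<in> basis_sum Y N x ` coef Y N x"
        using basis_sum_eq[OF Y a] coefI by blast
    qed
  qed
  ultimately show ?thesis
    unfolding linear_bij_betw_def bij_betw_def
    using basis_sum_eq[OF Y add] basis_sum_eq[OF Y scale] by blast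
qed

text \<open>
  The bridge from an arbitrary Banach space to the spaces over which universality quantifies. The
  witness \<open>V\<close> is the coefficient set itself, with the norm \<open>a \<mapsto> N (\<Sum>\<^sub>n a\<^sub>n x\<^sub>n)\<close>.
\<close>

lemma basic_sequence_in_sequence_space:
  assumes X: "banach_space X N" and x: "basic_sequence X N x"
  obtains V :: "(nat \<Rightarrow> real) set" and M
  where "banach_space V M" "separable_space (norm_topology V M)" "basic_sequence V M unit_sequence"
    and "coef V M unit_sequence = coef X N x"
    and "unconditional X N x \<longrightarrow> unconditional V M unit_sequence"
proof -
  note X' = banach_space_norm_on[OF X]
  define Y where "Y = closed_span X N x"
  have range: "range x \<subseteq> X" and basis: "schauder_basis Y N x"
    using x by (simp_all add: basic_sequence_def Y_def)
  have Y: "banach_space Y N" and Y': "norm_on Y N"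
    using banach_space_closed_span[OF X range] banach_space_norm_on by (simp_all add: Y_def)
  have xY: "x i \<in> Y" for i
    using basis by (auto simp: schauder_basis_def)
  define S where "S = basis_sum Y N x"
  define V where "V = coef Y N x"
  define M where "M a = N (S a)" for a
  have S: "linear_bij_betw S V Y"
    unfolding S_def V_def by (rule linear_bij_basis_sum[OF Y' basis])
  have e: "unit_sequence n \<in> V" and Se: "S (unit_sequence n) = x n" for n
    using series_sums_unit_sequence[of Y N x n, OF Y' xY] basis_sum_eq[OF Y']
    by (auto simp: V_def S_def coef_def series_converges_def)
  have M: "M = (\<lambda>a. N (S a))"
    by (simp add: M_def fun_eq_iff)
  have V: "banach_space V M" and V': "norm_on V M"
    using banach_space_pullback[OF S Y] norm_on_pullback[OF S Y'] by (simp_all add: M)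
  have Vbasis: "schauder_basis V M unit_sequence"
    using schauder_basis_pullback[OF S Y' e] basis by (simp add: M Se)
  show thesis
  proof (rule that[OF V])
    show "separable_space (norm_topology V M)"
      by (rule separable_of_schauder_basis[OF V' Vbasis])
    show "basic_sequence V M unit_sequence"
      by (rule basic_sequence_of_schauder_basis[OF V' Vbasis])
    show "coef V M unit_sequence = coef X N x"
      using coef_pullback[OF S Y' e] coef_closed_span[OF X' range] by (simp add: M Se Y_def)
    show "unconditional X N x \<longrightarrow> unconditional V M unit_sequence"
      using unconditional_pullback[OF S Y' e] unconditional_closed_span[OF X' range]
      by (simp add: M Se Y_def)
  qed
qed


section \<open>Spreading a sequence along a subsequence\<close>

definition spread :: "(nat \<Rightarrow> nat) \<Rightarrow> (nat \<Rightarrow> real) \<Rightarrow> nat \<Rightarrow> real"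
  where "spread k a m = (if m \<in> range k then a (inv k m) else 0)"

lemma limitin_compose:
  assumes "limitin T f l F" "filterlim g F G"
  shows "limitin T (\<lambda>n. f (g n)) l G"
  using assms by (auto simp: limitin_def filterlim_iff)

text \<open>
  If \<open>c m\<close> counts the indices \<open>n\<close> with \<open>k n < m\<close>, then the \<open>m\<close>-th partial sum of the spread series is
  the \<open>(c m)\<close>-th partial sum of the original one, and \<open>c (k n) = n\<close>. As \<open>c\<close> and \<open>k\<close> both tend to
  infinity, each sequence of partial sums is a reindexing of the other.
\<close>

lemma series_sums_spread_iff:
  assumes k: "strict_mono k"
  shows "series_sums U M (\<lambda>m. spread k a m *\<^sub>R u m) s \<longleftrightarrow> series_sums U M (\<lambda>n. a n *\<^sub>R u (k n)) s"
proof -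
  define P where "P n = (\<Sum>i<n. a i *\<^sub>R u (k i))" for n
  define Q where "Q m = (\<Sum>i<m. spread k a i *\<^sub>R u i)" for m
  define c where "c m = (LEAST n. m \<le> k n)" for m
  have inj: "inj k"
    using k by (rule strict_mono_imp_inj_on)
  have ex: "\<exists>n. m \<le> k n" for m
    using strict_mono_imp_increasing[OF k] by blast
  have c_iff: "k n < m \<longleftrightarrow> n < c m" for n m
  proof -
    have "m \<le> k (c m)"
      unfolding c_def using ex by (rule LeastI_ex)
    then have "n < c m" if "k n < m"
      using that strict_mono_less[OF k] by (meson less_le_trans)
    moreover have "k n < m" if "n < c m"
      using that not_less_Least[of n "\<lambda>n. m \<le> k n"] by (simp add: c_def)
    ultimately show ?thesis
      by blast
  qed
  have Q: "Q m = P (c m)" for m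
  proof -
    have "Q m = (\<Sum>i\<in>k ` {..<c m}. spread k a i *\<^sub>R u i)"
      unfolding Q_def by (rule sum.mono_neutral_right) (auto simp: c_iff spread_def)
    also have "\<dots> = (\<Sum>n<c m. spread k a (k n) *\<^sub>R u (k n))"
      using inj by (subst sum.reindex) (auto intro: inj_on_subset)
    also have "\<dots> = P (c m)"
      unfolding P_def by (simp add: spread_def inj)
    finally show ?thesis .
  qed
  have ck: "c (k n) = n" for n
    using c_iff[of _ "k n"] strict_mono_less[OF k] by (metis less_irrefl nat_neq_iff)
  have "filterlim c sequentially sequentially"
    unfolding filterlim_at_top
  proof
    fix n
    show "\<forall>\<^sub>F m in sequentially. n \<le> c m"
      using eventually_gt_at_top[of "k n"] by eventually_elim (simp add: c_iff less_imp_le)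
  qed
  moreover have "filterlim k sequentially sequentially"
    using k by (rule filterlim_subseq)
  moreover have "Q = (\<lambda>m. P (c m))" "P = (\<lambda>n. Q (k n))"
    by (simp_all add: Q ck fun_eq_iff)
  ultimately have "limitin T Q s sequentially \<longleftrightarrow> limitin T P s sequentially" for T
    using limitin_compose[of T P s sequentially c sequentially]
      limitin_compose[of T Q s sequentially k sequentially] by metis
  then show ?thesis
    by (simp add: series_sums_def P_def[abs_def] Q_def[abs_def])
qed

lemma spread_diff: "spread k a - spread k b = spread k (a - b)"
  by (simp add: spread_def fun_eq_iff)

text \<open>
  Every coordinate of the spread sequence is either a coordinate of the argument or constantly zero,
  so \<^term>\<open>spread k\<close> is continuous for the product topology.
\<close>

lemma spread_borel_measurable: "spread k \<in> borel_measurable borel"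
proof (rule borel_measurable_continuous_onI, rule continuous_on_coordinatewise_then_product)
  fix m
  show "continuous_on UNIV (\<lambda>a. spread k a m)"
    by (cases "m \<in> range k")
      (simp_all add: spread_def continuous_on_product_coordinates)
qed

lemma coef_equiv_reducible_to_subsequence:
  assumes k: "strict_mono k" and coef: "coef X N x = coef U M (u \<circ> k)"
  shows "coef_equiv X N x \<le>\<^sub>B coef_equiv U M u"
  unfolding borel_reducible_def
proof (intro bexI allI)
  fix a b
  have "(a, b) \<in> coef_equiv X N x \<longleftrightarrow> a - b \<in> coef U M (u \<circ> k)"
    by (simp add: coef_equiv_def coef)
  also have "\<dots> \<longleftrightarrow> spread k (a - b) \<in> coef U M u"
    unfolding coef_def series_converges_def mem_Collect_eq o_apply
    by (intro iff_exI series_sums_spread_iff[OF k, symmetric])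
  finally show "(a, b) \<in> coef_equiv X N x \<longleftrightarrow> (spread k a, spread k b) \<in> coef_equiv U M u"
    by (simp add: coef_equiv_def spread_diff)
qed (rule spread_borel_measurable)


section \<open>Universality\<close>

theorem theorem4p4:
  fixes U\<^sub>1 :: "'u::real_vector set" and N\<^sub>1 :: "'u \<Rightarrow> real" and u :: "nat \<Rightarrow> 'u"
    and U\<^sub>2 :: "'v::real_vector set" and N\<^sub>2 :: "'v \<Rightarrow> real" and v :: "nat \<Rightarrow> 'v"
  assumes "universal_unconditional_basis U\<^sub>1 N\<^sub>1 u"
    and "universal_schauder_basis U\<^sub>2 N\<^sub>2 v"
  shows "(\<forall>(X :: 'a::real_vector set) N x.
            banach_space X N \<and> basic_sequence X N x \<and> unconditional X N x \<longrightarrow>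
            coef_equiv X N x \<le>\<^sub>B coef_equiv U\<^sub>1 N\<^sub>1 u) \<and>
         (\<forall>(X :: 'a::real_vector set) N x.
            banach_space X N \<and> basic_sequence X N x \<longrightarrow>
            coef_equiv X N x \<le>\<^sub>B coef_equiv U\<^sub>2 N\<^sub>2 v)"
proof (intro conjI allI impI; elim conjE)
  fix X :: "'a set" and N x
  assume X: "banach_space X N" "basic_sequence X N x"
  obtain V :: "(nat \<Rightarrow> real) set" and M
    where V: "banach_space V M" "separable_space (norm_topology V M)"
        "basic_sequence V M unit_sequence"
      and coef: "coef V M unit_sequence = coef X N x"
      and unc: "unconditional X N x \<longrightarrow> unconditional V M unit_sequence"
    by (rule basic_sequence_in_sequence_space[OF X])
  {
    assume "unconditional X N x"
    then obtain k where "strict_mono k" "equivalent_sequences V M unit_sequence U\<^sub>1 N\<^sub>1 (u \<circ> k)"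
      using assms(1) V unc unfolding universal_unconditional_basis_def by blast
    then show "coef_equiv X N x \<le>\<^sub>B coef_equiv U\<^sub>1 N\<^sub>1 u"
      by (intro coef_equiv_reducible_to_subsequence) (simp_all add: equivalent_sequences_def coef)
  }
  obtain k where "strict_mono k" "equivalent_sequences V M unit_sequence U\<^sub>2 N\<^sub>2 (v \<circ> k)"
    using assms(2) V unfolding universal_schauder_basis_def by blast
  then show "coef_equiv X N x \<le>\<^sub>B coef_equiv U\<^sub>2 N\<^sub>2 v"
    by (intro coef_equiv_reducible_to_subsequence) (simp_all add: equivalent_sequences_def coef)
qed

end
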